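(* Let $\nu\in(0,1]$, $\lambda_\alpha,\lambda_\beta>0$. Let $N^\nu(t)$, $t>0$, be a fractional Poisson process with parameter $\lambda_\beta$, let $\tau_k^\nu=\inf\{t:N^\nu(t)=k\}$, $k\ge1$, and let $N_\alpha$ be a homogeneous Poisson process with rate $\lambda_\alpha$ independent of $N^\nu$. Then for every integer $k\ge1$, $$N_\alpha(\tau_k^\nu)\overset{d}{=}\xi_1^\nu+\dots+\xi_k^\nu,$$ where $\xi_1^\nu,\dots,\xi_k^\nu$ are independent discrete Mittag--Leffler random variables with parameters $\nu$ and $\lambda_\alpha^\nu/\lambda_\beta$.
   Context: The fractional Poisson process $N^\nu$ with parameter $\lambda_\beta$ is the renewal counting process whose i.i.d. inter-arrival times $W$ satisfy $\Pr\{W>t\}=E_{\nu,1}(-\lambda_\beta t^\nu)$, $t\ge0$, where $E_{\nu,1}(x)=\sum_{r\ge0}\frac{x^r}{\Gamma(\nu r+1)}$ is the Mittag--Leffler function. A non-negative integer-valued random variable $\xi$ is discrete Mittag--Leffler with parameters $\nu\in(0,1]$ and $c>0$ if its probability generating function is $\mathbb{E}u^{\xi}=\left[1+c(1-u)^\nu\right]^{-1}$, $|u|\le1$ (principal power). *)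

theory Defs
  imports "HOL-Probability.Probability"
begin

definition mittag_leffler :: "real \<Rightarrow> real \<Rightarrow> real \<Rightarrow> real" where
  "mittag_leffler a b x = (\<Sum>r. x ^ r / Gamma (a * real r + b))"

text \<open>
  All counting processes are indexed by real time, but only times \<open>t \<ge> 0\<close> matter. As usual for
  counting processes, path properties are required of every path.
\<close>

definition arrival_time :: "(nat \<Rightarrow> 'a \<Rightarrow> real) \<Rightarrow> nat \<Rightarrow> 'a \<Rightarrow> real" where
  "arrival_time W n \<omega> = (\<Sum>i<n. W i \<omega>)"

context prob_space
begin

text \<open>
  \<open>W i\<close> is the waiting time between the \<open>i\<close>-th and the \<open>(i+1)\<close>-st event. The set of arrivals
  up to time \<open>t\<close> is finite outside a null set; on that null set \<^const>\<open>card\<close> yields \<open>0\<close>.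
\<close>

definition renewal_counting_process ::
    "(nat \<Rightarrow> 'a \<Rightarrow> real) \<Rightarrow> (real \<Rightarrow> 'a \<Rightarrow> nat) \<Rightarrow> bool" where
  "renewal_counting_process W N \<longleftrightarrow>
     indep_vars (\<lambda>_. borel) W UNIV \<and>
     (\<forall>i. distr M borel (W i) = distr M borel (W 0)) \<and>
     (\<forall>i. \<forall>\<omega>\<in>space M. 0 < W i \<omega>) \<and>
     (\<forall>t\<ge>0. \<forall>\<omega>\<in>space M. N t \<omega> = card {n. 1 \<le> n \<and> arrival_time W n \<omega> \<le> t})"

definition fractional_poisson_process ::
    "real \<Rightarrow> real \<Rightarrow> (real \<Rightarrow> 'a \<Rightarrow> nat) \<Rightarrow> bool" where
  "fractional_poisson_process \<nu> rate N \<longleftrightarrow>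
     (\<exists>W. renewal_counting_process W N \<and>
          (\<forall>i. \<forall>t\<ge>0. prob {\<omega> \<in> space M. t < W i \<omega>} =
             mittag_leffler \<nu> 1 (- rate * t powr \<nu>)))"

definition poisson_process :: "real \<Rightarrow> (real \<Rightarrow> 'a \<Rightarrow> nat) \<Rightarrow> bool" where
  "poisson_process rate N \<longleftrightarrow>
     (\<forall>t\<ge>0. random_variable (count_space UNIV) (N t)) \<and>
     (\<forall>\<omega>\<in>space M. N 0 \<omega> = 0 \<and> mono_on {0..} (\<lambda>t. N t \<omega>) \<and>
        (\<forall>t\<ge>0. continuous (at_right t) (\<lambda>s. N s \<omega>))) \<and>
     (\<forall>s t. 0 \<le> s \<and> s < t \<longrightarrow>
        distr M (count_space UNIV) (\<lambda>\<omega>. N t \<omega> - N s \<omega>) =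
          measure_pmf (poisson_pmf (rate * (t - s)))) \<and>
     (\<forall>n (p :: nat \<Rightarrow> real). 0 \<le> p 0 \<and> (\<forall>i<n. p i < p (Suc i)) \<longrightarrow>
        indep_vars (\<lambda>_. count_space UNIV) (\<lambda>i \<omega>. N (p (Suc i)) \<omega> - N (p i) \<omega>) {..<n})"

text \<open>
  Independence of whole processes, that is, of the random elements
  \<open>\<omega> \<mapsto> (N t \<omega>)\<^sub>t\<close> of the product space over \<open>[0,\<infinity>)\<close>.
\<close>

definition indep_processes ::
    "(real \<Rightarrow> 'a \<Rightarrow> nat) \<Rightarrow> (real \<Rightarrow> 'a \<Rightarrow> nat) \<Rightarrow> bool" where
  "indep_processes N N' \<longleftrightarrow>
     indep_var (Pi\<^sub>M {0..} (\<lambda>_. count_space UNIV)) (\<lambda>\<omega>. \<lambda>t\<in>{0..}. N t \<omega>)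
               (Pi\<^sub>M {0..} (\<lambda>_. count_space UNIV)) (\<lambda>\<omega>. \<lambda>t\<in>{0..}. N' t \<omega>)"

text \<open>
  The generating function is taken on the closed complex unit disc. There \<open>1 - u\<close> has nonnegative
  real part, and \<open>powr\<close> on \<^typ>\<open>complex\<close> is the principal power with \<open>0 powr \<nu> = 0\<close>.
\<close>

definition discrete_mittag_leffler :: "real \<Rightarrow> real \<Rightarrow> ('a \<Rightarrow> nat) \<Rightarrow> bool" where
  "discrete_mittag_leffler \<nu> c X \<longleftrightarrow>
     random_variable (count_space UNIV) X \<and>
     (\<forall>u::complex. norm u \<le> 1 \<longrightarrow>
        expectation (\<lambda>\<omega>. u ^ X \<omega>) =
          inverse (1 + complex_of_real c * (1 - u) powr complex_of_real \<nu>))"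

end

definition first_time :: "(real \<Rightarrow> 'a \<Rightarrow> nat) \<Rightarrow> nat \<Rightarrow> 'a \<Rightarrow> real" where
  "first_time N k \<omega> = Inf {t. 0 < t \<and> N t \<omega> = k}"

end

(*
  Both sides are compared through their generating functions at real u in [0,1). Conditioning on
  the k-th arrival time T_k of the renewal process turns the left one into the Laplace transform of
  T_k at s = rate_alpha * (1 - u), which is the k-th power of the Laplace transform
  rate_beta / (rate_beta + s^nu) of one waiting time; this is the product of the generating
  functions of the discrete Mittag-Leffler variables.
*)

theory Submission
  imports Defs "HOL-Complex_Analysis.Complex_Analysis" "HOL-Real_Asymp.Real_Asymp"
begin

text \<open>Two obstacles shape the proof. The Mittag-Leffler series can be integrated against
  \<open>exp (- s * t)\<close> term by term only when \<open>s powr \<nu>\<close> exceeds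
  \<open>rate\<^sub>\<beta>\<close>, while small \<open>s\<close> occur as \<open>u\<close>
  approaches 1. The remaining \<open>s\<close> are reached through a Poisson mixture: a Poisson
  count with random mean \<open>l * W\<close> has a generating function that is both a power series
  on the unit disc and the Laplace transform of \<open>W\<close> at \<open>l * (1 - u)\<close>, so
  the identity theorem applies. The other obstacle is the random time. Independence is given for
  paths in a product space, where an event depends on countably many times only, but
  \<open>N\<^sub>\<alpha>\<close> is evaluated at an arbitrary real time. Right-continuity reduces
  this to dyadic times, and the arrival time is read off the path of \<open>N\<close> at rational
  times. Generating functions on [0,1) suffice because a power series is determined by its values
  near 0; leaving out \<open>u = 1\<close> keeps \<open>s\<close> positive.\<close>

section \<open>Laplace transform of the Mittag-Leffler series for large arguments\<close>

text \<open>Euler's integral for \<open>Gamma (a + 1)\<close> with \<open>s * t\<close> substituted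
  for the variable. Computing in \<open>ennreal\<close> yields integrability together with the
  value.\<close>

lemma has_bochner_integral_exp_powr:
  fixes a s :: real
  assumes "-1 < a" "0 < s"
  shows "has_bochner_integral lborel (\<lambda>t. indicator {0<..} t * (exp (- s * t) * t powr a))
           (Gamma (a + 1) / s powr (a + 1))"
proof (rule has_bochner_integral_nn_integral)
  have "ennreal (Gamma (a + 1)) =
      (\<integral>\<^sup>+t. ennreal (indicator {0..} t * t powr a / exp t) \<partial>lborel)"
    using Gamma_conv_nn_integral_real[of "a + 1"] assms by simp
  also have "\<dots> = ennreal \<bar>s\<bar> *
      (\<integral>\<^sup>+t. ennreal (indicator {0..} (0 + s * t) * (0 + s * t) powr a / exp (0 + s * t)) \<partial>lborel)"
    using assms by (intro nn_integral_real_affine) auto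
  also have "(\<integral>\<^sup>+t. ennreal (indicator {0..} (0 + s * t) * (0 + s * t) powr a / exp (0 + s * t)) \<partial>lborel)
      = (\<integral>\<^sup>+t. ennreal (s powr a) *
           ennreal (indicator {0<..} t * (exp (- s * t) * t powr a)) \<partial>lborel)"
    using AE_lborel_singleton[of "0::real"] assms
    by (intro nn_integral_cong_AE)
       (auto simp: indicator_def powr_mult exp_minus field_simps zero_le_mult_iff
             simp flip: ennreal_mult)
  also have "\<dots> = ennreal (s powr a) *
      (\<integral>\<^sup>+t. ennreal (indicator {0<..} t * (exp (- s * t) * t powr a)) \<partial>lborel)"
    by (rule nn_integral_cmult) auto
  also have "ennreal \<bar>s\<bar> * (ennreal (s powr a) *
      (\<integral>\<^sup>+t. ennreal (indicator {0<..} t * (exp (- s * t) * t powr a)) \<partial>lborel)) =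
      ennreal (s powr (a + 1)) *
      (\<integral>\<^sup>+t. ennreal (indicator {0<..} t * (exp (- s * t) * t powr a)) \<partial>lborel)"
    using assms by (simp add: powr_add ennreal_mult ac_simps)
  finally have *: "ennreal (Gamma (a + 1)) = \<dots>" .
  have "(\<integral>\<^sup>+t. ennreal (indicator {0<..} t * (exp (- s * t) * t powr a)) \<partial>lborel) =
      ennreal (1 / s powr (a + 1)) * (ennreal (s powr (a + 1)) *
      (\<integral>\<^sup>+t. ennreal (indicator {0<..} t * (exp (- s * t) * t powr a)) \<partial>lborel))"
    using assms by (simp add: mult.assoc[symmetric] flip: ennreal_mult)
  also have "\<dots> = ennreal (Gamma (a + 1) / s powr (a + 1))"
    unfolding *[symmetric] using assms Gamma_real_pos[of "a+1"] by (simp flip: ennreal_mult)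
  finally show "(\<integral>\<^sup>+t. ennreal (indicator {0<..} t * (exp (- s * t) * t powr a)) \<partial>lborel) =
      ennreal (Gamma (a + 1) / s powr (a + 1))" .
  show "0 \<le> Gamma (a + 1) / s powr (a + 1)"
    using assms Gamma_real_pos[of "a+1"] by simp
qed (auto intro!: AE_I2)

text \<open>Integrating the \<open>r\<close>-th term of the series produces a factor
  \<open>Gamma (\<nu> * real r + 1)\<close> that cancels its denominator, so a geometric series in
  \<open>c / s powr \<nu>\<close> remains. The bound on \<open>c\<close> is the convergence
  condition of that series.\<close>

lemma has_bochner_integral_mittag_leffler:
  fixes \<nu> c s :: real
  assumes "0 < \<nu>" "0 < s" and c: "\<bar>c\<bar> < s powr \<nu>"
  shows "has_bochner_integral lborel
           (\<lambda>t. indicator {0<..} t * (exp (- s * t) * mittag_leffler \<nu> 1 (c * t powr \<nu>)))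
           (s powr \<nu> / (s * (s powr \<nu> - c)))"
proof -
  \<comment> \<open>The coefficient is a parameter of \<open>g\<close> because the norm of
    \<open>g c r t\<close> is \<open>g \<bar>c\<bar> r t\<close>; thus \<open>hbi\<close> also
    evaluates the integrals of the norms.\<close>
  define g where "g c r t =
      indicator {0<..} t * (exp (- s * t) * ((c * t powr \<nu>) ^ r / Gamma (\<nu> * real r + 1)))"
    for c :: real and r :: nat and t :: real
  have g_eq: "g c r t =
      c ^ r / Gamma (\<nu> * real r + 1) * (indicator {0<..} t * (exp (- s * t) * t powr (\<nu> * real r)))"
    for c r t
    by (auto simp: g_def indicator_def power_mult_distrib powr_power mult_ac)
  have hbi: "has_bochner_integral lborel (g c r) (1 / s * (c / s powr \<nu>) ^ r)" for c r
  proof -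
    have pos: "0 < Gamma (\<nu> * real r + 1)"
      using assms by (intro Gamma_real_pos add_nonneg_pos) auto
    have "has_bochner_integral lborel (\<lambda>t. c ^ r / Gamma (\<nu> * real r + 1) *
        (indicator {0<..} t * (exp (- s * t) * t powr (\<nu> * real r))))
        (c ^ r / Gamma (\<nu> * real r + 1) *
          (Gamma (\<nu> * real r + 1) / s powr (\<nu> * real r + 1)))"
      using assms by (intro has_bochner_integral_mult_right has_bochner_integral_exp_powr)
        (auto intro: less_le_trans[of _ 0])
    also have "c ^ r / Gamma (\<nu> * real r + 1) *
        (Gamma (\<nu> * real r + 1) / s powr (\<nu> * real r + 1)) = 1 / s * (c / s powr \<nu>) ^ r"
      using pos assms by (simp add: powr_add powr_power power_divide field_simps)
    finally show ?thesis by (simp add: g_eq[abs_def])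
  qed
  have norm_g: "norm (g c r t) = g \<bar>c\<bar> r t" for r t
  proof -
    have "0 < Gamma (\<nu> * real r + 1)"
      using assms by (intro Gamma_real_pos add_nonneg_pos) auto
    then show ?thesis
      by (simp add: g_def abs_mult power_abs)
  qed
  have geo: "(\<lambda>r. 1 / s * (x / s powr \<nu>) ^ r) sums (1 / s * (1 / (1 - x / s powr \<nu>)))"
    if "\<bar>x\<bar> < s powr \<nu>" for x
    using that assms by (intro sums_mult geometric_sums) auto
  have int_norm: "(\<integral>t. norm (g c r t) \<partial>lborel) = 1 / s * (\<bar>c\<bar> / s powr \<nu>) ^ r" for r
    unfolding norm_g using hbi by (rule has_bochner_integral_integral_eq)
  have sum_norm: "summable (\<lambda>r. \<integral>t. norm (g c r t) \<partial>lborel)"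
    unfolding int_norm using geo[of "\<bar>c\<bar>"] c by (auto simp: sums_iff)
  \<comment> \<open>Tonelli: the sum of the norms has a finite integral and is therefore finite
    almost everywhere. This gives convergence of the Mittag-Leffler series at almost every
    \<open>t > 0\<close> without any estimate of Gamma.\<close>
  have "(\<integral>\<^sup>+t. (\<Sum>r. ennreal (norm (g c r t))) \<partial>lborel) =
      (\<Sum>r. \<integral>\<^sup>+t. ennreal (norm (g c r t)) \<partial>lborel)"
    by (rule nn_integral_suminf) (auto simp: g_def)
  also have "\<dots> = (\<Sum>r. ennreal (\<integral>t. norm (g c r t) \<partial>lborel))"
    using hbi by (intro suminf_cong nn_integral_eq_integral integrable_norm AE_I2)
      (auto simp: has_bochner_integral_iff)
  also have "\<dots> \<noteq> \<infinity>"
    using sum_norm by (simp add: suminf_ennreal2)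
  finally have "AE t in lborel. (\<Sum>r. ennreal (norm (g c r t))) \<noteq> \<infinity>"
    by (intro nn_integral_PInf_AE) (auto simp: g_def)
  then have AE_sum: "AE t in lborel. summable (\<lambda>r. norm (g c r t))"
    by eventually_elim (rule summable_suminf_not_top, auto)
  have sum_g: "(\<Sum>r. g c r t) =
      indicator {0<..} t * (exp (- s * t) * mittag_leffler \<nu> 1 (c * t powr \<nu>))"
    if "summable (\<lambda>r. norm (g c r t))" for t
  proof (cases "0 < t")
    case True
    \<comment> \<open>Pulling \<open>exp (- s * t)\<close> out of the sum requires the bare series
      to be summable; multiplying by \<open>exp (s * t)\<close> recovers it from the terms
      \<open>g c r t\<close>.\<close>
    have "summable (\<lambda>r. exp (s * t) * g c r t)"
      by (rule summable_mult[OF summable_norm_cancel[OF that]])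
    moreover have "exp (s * t) * g c r t = (c * t powr \<nu>) ^ r / Gamma (\<nu> * real r + 1)" for r
      using True by (simp add: g_def mult.assoc[symmetric] mult_exp_exp)
    ultimately have "summable (\<lambda>r. (c * t powr \<nu>) ^ r / Gamma (\<nu> * real r + 1))"
      by simp
    then have "(\<Sum>r. exp (- s * t) * ((c * t powr \<nu>) ^ r / Gamma (\<nu> * real r + 1))) =
        exp (- s * t) * mittag_leffler \<nu> 1 (c * t powr \<nu>)"
      unfolding mittag_leffler_def by (rule suminf_mult)
    then show ?thesis
      using True by (simp add: g_def)
  qed (simp add: g_def)
  have int: "integrable lborel (g c r)" for r
    using hbi[of c r] by (rule integrable.intros)
  have "integrable lborel (\<lambda>t. \<Sum>r. g c r t)"
    by (rule integrable_suminf[OF int AE_sum sum_norm])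
  moreover have "(\<integral>t. (\<Sum>r. g c r t) \<partial>lborel) = (\<Sum>r. integral\<^sup>L lborel (g c r))"
    by (rule integral_suminf[OF int AE_sum sum_norm])
  moreover have "(\<Sum>r. integral\<^sup>L lborel (g c r)) = s powr \<nu> / (s * (s powr \<nu> - c))"
  proof -
    have "(\<Sum>r. integral\<^sup>L lborel (g c r)) = (\<Sum>r. 1 / s * (c / s powr \<nu>) ^ r)"
      by (intro suminf_cong has_bochner_integral_integral_eq hbi)
    also have "\<dots> = 1 / s * (1 / (1 - c / s powr \<nu>))"
      by (rule sums_unique[OF geo[OF c], symmetric])
    also have "\<dots> = s powr \<nu> / (s * (s powr \<nu> - c))"
    proof -
      have "s powr \<nu> \<noteq> 0" "s powr \<nu> - c \<noteq> 0"
        using assms by auto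
      then show ?thesis
        by (simp add: divide_simps)
    qed
    finally show ?thesis .
  qed
  ultimately have *: "has_bochner_integral lborel (\<lambda>t. \<Sum>r. g c r t)
      (s powr \<nu> / (s * (s powr \<nu> - c)))"
    by (simp add: has_bochner_integral_iff)
  have [measurable]: "(\<lambda>t. mittag_leffler \<nu> 1 (c * t powr \<nu>)) \<in> borel_measurable borel"
    unfolding mittag_leffler_def by measurable
  have "AE t in lborel. (\<Sum>r. g c r t) =
      indicator {0<..} t * (exp (- s * t) * mittag_leffler \<nu> 1 (c * t powr \<nu>))"
    using AE_sum by (rule eventually_mono) (rule sum_g)
  moreover have "(\<lambda>t. \<Sum>r. g c r t) \<in> borel_measurable lborel"
    by (intro borel_measurable_suminf) (simp add: g_def)
  ultimately show ?thesis
    using * by (subst has_bochner_integral_cong_AE[symmetric]) auto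
qed

text \<open>Tonelli applied to the fact that \<open>1 - exp (- s * w)\<close> is the integral of
  \<open>s * exp (- s * t)\<close> over 0 < t < w: after the swap, the inner integral of the event
  \<open>t < W \<omega>\<close> is the survival function.\<close>

lemma (in prob_space) integral_one_minus_exp_eq_survival:
  assumes W[measurable]: "random_variable borel W" and pos: "\<And>\<omega>. \<omega> \<in> space M \<Longrightarrow> 0 < W \<omega>"
    and s: "0 < (s::real)"
  shows "expectation (\<lambda>\<omega>. 1 - exp (- s * W \<omega>)) =
    (\<integral>t. indicator {0<..} t * (s * (exp (- s * t) * prob {\<omega> \<in> space M. t < W \<omega>})) \<partial>lborel)"
proof -
  interpret pair_sigma_finite M lborel ..
  have 1: "ennreal (1 - exp (- s * w)) =
      (\<integral>\<^sup>+t. ennreal (indicator {0<..} t * (s * exp (- s * t)) * indicator {..<w} t) \<partial>lborel)"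
    if "0 < w" for w
  proof -
    have "(\<integral>\<^sup>+t. ennreal (s * exp (- s * t)) * indicator {0..w} t \<partial>lborel) =
        ennreal (- exp (- s * w) - - exp (- s * 0))"
      using s that by (intro nn_integral_FTC_Icc)
        (auto intro!: derivative_eq_intros)
    also have "(\<integral>\<^sup>+t. ennreal (s * exp (- s * t)) * indicator {0..w} t \<partial>lborel) =
      (\<integral>\<^sup>+t. ennreal (indicator {0<..} t * (s * exp (- s * t)) * indicator {..<w} t) \<partial>lborel)"
      using AE_lborel_singleton[of "0::real"] AE_lborel_singleton[of w]
      by (intro nn_integral_cong_AE) (auto simp: indicator_def)
    finally show ?thesis by simp
  qed
  have "ennreal (expectation (\<lambda>\<omega>. 1 - exp (- s * W \<omega>))) =
      (\<integral>\<^sup>+\<omega>. ennreal (1 - exp (- s * W \<omega>)) \<partial>M)"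
    using s pos 
    by (intro nn_integral_eq_integral[symmetric] integrable_const_bound[where B = 1] AE_I2)
       (auto simp: less_imp_le)
  also have "\<dots> = (\<integral>\<^sup>+\<omega>. (\<integral>\<^sup>+t. ennreal (indicator {0<..} t * (s * exp (- s * t)) *
      indicator {..<W \<omega>} t) \<partial>lborel) \<partial>M)"
    using pos by (intro nn_integral_cong 1)
  also have "\<dots> = (\<integral>\<^sup>+t. (\<integral>\<^sup>+\<omega>. ennreal (indicator {0<..} t * (s * exp (- s * t)) *
      indicator {..<W \<omega>} t) \<partial>M) \<partial>lborel)"
  proof (rule Fubini'[symmetric])
    have "(\<lambda>(\<omega>, t). ennreal (indicator {0<..} t * (s * exp (- s * t)) *
        (if t < W \<omega> then 1 else 0))) \<in> borel_measurable (M \<Otimes>\<^sub>M lborel)"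
      by measurable
    then show "(\<lambda>(\<omega>, t). ennreal (indicator {0<..} t * (s * exp (- s * t)) *
        indicator {..<W \<omega>} t)) \<in> borel_measurable (M \<Otimes>\<^sub>M lborel)"
      by (simp add: indicator_def)
  qed
  also have "\<dots> = (\<integral>\<^sup>+t. ennreal (indicator {0<..} t *
      (s * (exp (- s * t) * prob {\<omega> \<in> space M. t < W \<omega>}))) \<partial>lborel)"
  proof (rule nn_integral_cong)
    fix t :: real
    have "(\<integral>\<^sup>+\<omega>. ennreal (indicator {0<..} t * (s * exp (- s * t)) * indicator {..<W \<omega>} t) \<partial>M) =
      (\<integral>\<^sup>+\<omega>. ennreal (indicator {0<..} t * (s * exp (- s * t))) *
         indicator {\<omega> \<in> space M. t < W \<omega>} \<omega> \<partial>M)"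
      using s by (intro nn_integral_cong) (auto simp: indicator_def)
    also have "\<dots> = ennreal (indicator {0<..} t * (s * exp (- s * t))) *
        ennreal (prob {\<omega> \<in> space M. t < W \<omega>})"
      by (subst nn_integral_cmult_indicator) (auto simp: emeasure_eq_measure)
    also have "\<dots> = ennreal (indicator {0<..} t *
      (s * (exp (- s * t) * prob {\<omega> \<in> space M. t < W \<omega>})))"
      using s by (simp add: mult_ac flip: ennreal_mult)
    finally show "(\<integral>\<^sup>+\<omega>. ennreal (indicator {0<..} t * (s * exp (- s * t)) *
        indicator {..<W \<omega>} t) \<partial>M) = \<dots>" .
  qed
  finally have *: "ennreal (expectation (\<lambda>\<omega>. 1 - exp (- s * W \<omega>))) = \<dots>" .
  have meas: "(\<lambda>t. prob {\<omega> \<in> space M. t < W \<omega>}) \<in> borel_measurable borel"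
  proof -
    have "mono (\<lambda>t. - prob {\<omega> \<in> space M. t < W \<omega>})"
      by (auto simp: mono_def intro!: finite_measure_mono)
    then have "(\<lambda>t. - (- prob {\<omega> \<in> space M. t < W \<omega>})) \<in> borel_measurable borel"
      by (intro borel_measurable_uminus borel_measurable_mono)
    then show ?thesis by simp
  qed
  have "expectation (\<lambda>\<omega>. 1 - exp (- s * W \<omega>)) \<ge> 0"
    using s pos by (intro integral_nonneg_AE AE_I2) (auto simp: less_imp_le)
  then have "expectation (\<lambda>\<omega>. 1 - exp (- s * W \<omega>)) =
      enn2real (ennreal (expectation (\<lambda>\<omega>. 1 - exp (- s * W \<omega>))))"
    by simp
  also have "\<dots> = (\<integral>t. indicator {0<..} t *
      (s * (exp (- s * t) * prob {\<omega> \<in> space M. t < W \<omega>})) \<partial>lborel)"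
    unfolding * using s meas
    by (subst integral_eq_nn_integral) auto
  finally show ?thesis .
qed

text \<open>The condition \<open>c < s powr \<nu>\<close> comes from the geometric series in
  \<open>has_bochner_integral_mittag_leffler\<close>, applied at \<open>- c\<close>;
  \<open>laplace_mittag_leffler_survival\<close> removes it.\<close>

lemma (in prob_space) laplace_mittag_leffler_survival_large:
  assumes W[measurable]: "random_variable borel W" and pos: "\<And>\<omega>. \<omega> \<in> space M \<Longrightarrow> 0 < W \<omega>"
    and surv: "\<And>t. 0 \<le> t \<Longrightarrow> prob {\<omega> \<in> space M. t < W \<omega>} = mittag_leffler \<nu> 1 (- c * t powr \<nu>)"
    and "0 < \<nu>" "0 < c" "0 < s" "c < s powr \<nu>"
  shows "expectation (\<lambda>\<omega>. exp (- s * W \<omega>)) = c / (c + s powr \<nu>)"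
proof -
  have int: "integrable M (\<lambda>\<omega>. exp (- s * W \<omega>))"
    using pos assms by (intro integrable_const_bound[where B = 1] AE_I2) (auto simp: less_imp_le)
  have "expectation (\<lambda>\<omega>. 1 - exp (- s * W \<omega>)) =
    (\<integral>t. indicator {0<..} t * (s * (exp (- s * t) * prob {\<omega> \<in> space M. t < W \<omega>})) \<partial>lborel)"
    using pos assms by (intro integral_one_minus_exp_eq_survival) auto
  also have "\<dots> = (\<integral>t. s * (indicator {0<..} t *
      (exp (- s * t) * mittag_leffler \<nu> 1 (- c * t powr \<nu>))) \<partial>lborel)"
    by (intro Bochner_Integration.integral_cong) (auto simp: surv indicator_def)
  also have "\<dots> = s * (s powr \<nu> / (s * (s powr \<nu> - - c)))"
    using assms
    by (intro has_bochner_integral_integral_eq has_bochner_integral_mult_right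
        has_bochner_integral_mittag_leffler) auto
  also have "\<dots> = s powr \<nu> / (s powr \<nu> + c)"
    using assms by simp
  finally have "1 - expectation (\<lambda>\<omega>. exp (- s * W \<omega>)) = s powr \<nu> / (s powr \<nu> + c)"
    using int by (simp add: prob_space)
  moreover have "s powr \<nu> / (s powr \<nu> + c) = 1 - c / (c + s powr \<nu>)"
    using assms by (simp add: field_simps add_pos_pos)
  ultimately show ?thesis
    by simp
qed

section \<open>Poisson mixtures and analytic continuation to all positive arguments\<close>

text \<open>One nonnegative term of the exponential series is bounded by the whole sum. The left
  side is the Poisson weight of \<open>n\<close> for mean \<open>x\<close>.\<close>

lemma power_div_fact_exp_le_1:
  fixes x :: real
  assumes "0 \<le> x"
  shows "x ^ n / fact n * exp (- x) \<le> 1"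
proof -
  have "x ^ n / fact n \<le> exp x"
    using assms
    by (subst exp_converges[THEN sums_unique])
      (auto simp: scaleR_conv_of_real divide_inverse_commute
        intro!: sum_le_suminf[of _ "{n}", simplified] summable_exp_generic[of x, simplified])
  then show ?thesis
    by (simp add: exp_minus field_simps)
qed

text \<open>\<open>a n\<close> is the probability that a Poisson variable with random mean
  \<open>l * W\<close> equals \<open>n\<close>. Summing the exponential series inside the
  expectation gives its generating function, which presents the Laplace transform of
  \<open>W\<close> as a power series in \<open>u\<close> with bounded coefficients.\<close>

lemma (in prob_space)
  fixes l :: real
  assumes W[measurable]: "random_variable borel W" and nonneg: "\<And>\<omega>. \<omega> \<in> space M \<Longrightarrow> 0 \<le> W \<omega>"
    and l: "0 \<le> l"
  defines "a \<equiv> \<lambda>n. expectation (\<lambda>\<omega>. (l * W \<omega>) ^ n / fact n * exp (- (l * W \<omega>)))"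
  shows poisson_mixture_coeff_bound: "\<bar>a n\<bar> \<le> 1"
    and poisson_mixture_sums: "0 \<le> u \<Longrightarrow> u < 1 \<Longrightarrow>
      (\<lambda>n. a n * u ^ n) sums expectation (\<lambda>\<omega>. exp (- (l * (1 - u)) * W \<omega>))"
proof -
  define h where "h n \<omega> = (l * W \<omega>) ^ n / fact n * exp (- (l * W \<omega>))" for n \<omega>
  have h01: "0 \<le> h n \<omega>" "h n \<omega> \<le> 1" if "\<omega> \<in> space M" for n \<omega>
    using nonneg[OF that] l power_div_fact_exp_le_1[of "l * W \<omega>" n] by (auto simp: h_def)
  have [measurable]: "h n \<in> borel_measurable M" for n
    unfolding h_def by measurable
  have int: "integrable M (h n)" for n
    using h01 by (intro integrable_const_bound[where B = 1] AE_I2) auto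
  have a_eq: "a n = expectation (h n)" for n
    unfolding a_def h_def by (rule refl)
  have a0: "0 \<le> a n" for n
    unfolding a_eq using h01 by (intro integral_nonneg_AE AE_I2) auto
  have a1: "a n \<le> 1" for n
    unfolding a_eq using h01 int by (intro integral_le_const AE_I2) auto
  show "\<bar>a n\<bar> \<le> 1"
    using a0 a1 by simp
  show "(\<lambda>n. a n * u ^ n) sums expectation (\<lambda>\<omega>. exp (- (l * (1 - u)) * W \<omega>))"
    if u: "0 \<le> u" "u < 1"
  proof -
    have sums: "(\<lambda>n. h n \<omega> * u ^ n) sums exp (- (l * (1 - u)) * W \<omega>)" for \<omega>
    proof -
      have "(\<lambda>n. exp (- (l * W \<omega>)) * ((l * W \<omega> * u) ^ n /\<^sub>R fact n)) sums
          (exp (- (l * W \<omega>)) * exp (l * W \<omega> * u))"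
        by (intro sums_mult exp_converges)
      then show ?thesis
        by (simp add: h_def scaleR_conv_of_real power_mult_distrib mult_exp_exp algebra_simps divide_inverse)
    qed
    have norm_eq: "norm (h n \<omega> * u ^ n) = h n \<omega> * u ^ n" if "\<omega> \<in> space M" for n \<omega>
      using h01[OF that] u by (simp add: abs_mult)
    have "(\<integral>\<omega>. norm (h n \<omega> * u ^ n) \<partial>M) = a n * u ^ n" for n
    proof -
      have "(\<integral>\<omega>. norm (h n \<omega> * u ^ n) \<partial>M) = (\<integral>\<omega>. h n \<omega> * u ^ n \<partial>M)"
        by (intro Bochner_Integration.integral_cong norm_eq refl)
      then show ?thesis
        by (simp add: a_eq)
    qed
    moreover have "summable (\<lambda>n. a n * u ^ n)"
      using u a0 a1 by (intro summable_comparison_test'[OF summable_geometric[of u]])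
        (auto intro: mult_left_le_one_le)
    moreover have "summable (\<lambda>n. norm (h n \<omega> * u ^ n))" if "\<omega> \<in> space M" for \<omega>
      unfolding norm_eq[OF that] using sums by (rule sums_summable)
    ultimately have "(\<lambda>n. \<integral>\<omega>. h n \<omega> * u ^ n \<partial>M) sums (\<integral>\<omega>. (\<Sum>n. h n \<omega> * u ^ n) \<partial>M)"
      using int by (intro sums_integral AE_I2) auto
    then show ?thesis
      using sums by (simp add: a_eq sums_iff)
  qed
qed

text \<open>The argument of \<open>z\<close> lies strictly between -pi/2 and pi/2, and multiplying
  it by \<open>\<nu> \<le> 1\<close> cannot leave that range. This keeps the denominator of the
  continued formula away from 0.\<close>

lemma Re_powr_nonneg:
  fixes z :: complex
  assumes "0 < Re z" "0 \<le> \<nu>" "\<nu> \<le> 1"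
  shows "0 \<le> Re (z powr complex_of_real \<nu>)"
proof -
  have z: "z \<noteq> 0"
    using assms by auto
  have "\<bar>Im (Ln z)\<bar> < pi / 2"
    using assms(1) Re_Ln_pos_lt[OF z] by blast
  moreover have "\<bar>\<nu> * Im (Ln z)\<bar> \<le> \<bar>Im (Ln z)\<bar>"
    using assms by (simp add: abs_mult mult_left_le_one_le)
  ultimately have "0 \<le> cos (\<nu> * Im (Ln z))"
    by (intro cos_ge_zero) linarith+
  then show ?thesis
    using z by (simp add: powr_def Re_exp)
qed

text \<open>
  For small \<open>s\<close> the Laplace transform of the Mittag-Leffler series cannot be computed term by
  term. In the variable \<open>u = 1 - s / l\<close> both sides are holomorphic on the unit disc, and the
  formula for large \<open>s\<close> covers all small \<open>u\<close> once \<open>l\<close> is large.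
\<close>

lemma (in prob_space) laplace_mittag_leffler_survival:
  assumes W[measurable]: "random_variable borel W" and pos: "\<And>\<omega>. \<omega> \<in> space M \<Longrightarrow> 0 < W \<omega>"
    and surv: "\<And>t. 0 \<le> t \<Longrightarrow> prob {\<omega> \<in> space M. t < W \<omega>} = mittag_leffler \<nu> 1 (- c * t powr \<nu>)"
    and \<nu>: "0 < \<nu>" "\<nu> \<le> 1" and c: "0 < c" and s: "0 < s"
  shows "expectation (\<lambda>\<omega>. exp (- s * W \<omega>)) = c / (c + s powr \<nu>)"
proof -
  \<comment> \<open>\<open>l > s\<close> places the target \<open>u = 1 - s / l\<close> in [0,1).
    Also \<open>l / 2 > c powr (1 / \<nu>)\<close>, so for \<open>u < 1 / 2\<close> the argument
    \<open>l * (1 - u)\<close> is in the range of the large-argument formula.\<close>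
  define l where "l = 2 * (s + c powr (1 / \<nu>))"
  have l: "0 < l" "s < l"
    using s c by (auto simp: l_def intro!: add_pos_nonneg)
  define a where "a n = expectation (\<lambda>\<omega>. (l * W \<omega>) ^ n / fact n * exp (- (l * W \<omega>)))" for n
  define F where "F z = (\<Sum>n. complex_of_real (a n) * z ^ n)" for z
  define G where "G z = complex_of_real c /
      (complex_of_real c + complex_of_real (l powr \<nu>) * (1 - z) powr complex_of_real \<nu>)" for z
  have abs_a: "\<bar>a n\<bar> \<le> 1" for n
    unfolding a_def using pos l by (intro poisson_mixture_coeff_bound) (auto simp: less_imp_le)
  have F_sums: "(\<lambda>n. complex_of_real (a n) * z ^ n) sums F z" if "norm z < 1" for z
    unfolding F_def
  proof (rule summable_sums, rule summable_comparison_test'[OF summable_geometric])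
    show "norm (complex_of_real (a n) * z ^ n) \<le> norm z ^ n" if "n \<ge> 0" for n
      using abs_a by (auto simp: norm_mult norm_power intro!: mult_left_le_one_le)
  qed (use that in simp)
  have holF: "F holomorphic_on ball 0 1"
    by (rule power_series_holomorphic[where a = "\<lambda>n. complex_of_real (a n)"]) (simp add: F_sums)
  have Re_pos: "0 < Re (1 - z)" if "z \<in> ball 0 1" for z
    using that complex_Re_le_cmod[of z] by simp
  have denom: "complex_of_real c + complex_of_real (l powr \<nu>) * (1 - z) powr complex_of_real \<nu> \<noteq> 0"
    if "z \<in> ball 0 1" for z
  proof -
    have "0 < Re (complex_of_real c + complex_of_real (l powr \<nu>) * (1 - z) powr complex_of_real \<nu>)"
      using Re_powr_nonneg[OF Re_pos[OF that]] c \<nu> by (simp add: add_pos_nonneg)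
    then show ?thesis
      by force
  qed
  \<comment> \<open>\<open>1 - z\<close> has positive real part on the disc and so avoids the branch
    cut of the principal power.\<close>
  have holG: "G holomorphic_on ball 0 1"
    unfolding G_def
    using Re_pos by (intro holomorphic_intros denom) (force simp: complex_nonpos_Reals_iff)+
  have F_real: "F (of_real u) = of_real (expectation (\<lambda>\<omega>. exp (- (l * (1 - u)) * W \<omega>)))"
    if "0 \<le> u" "u < 1" for u
  proof -
    have "(\<lambda>n. a n * u ^ n) sums expectation (\<lambda>\<omega>. exp (- (l * (1 - u)) * W \<omega>))"
      unfolding a_def using pos l that by (intro poisson_mixture_sums) (auto simp: less_imp_le)
    then have "(\<lambda>n. complex_of_real (a n * u ^ n)) sums
        of_real (expectation (\<lambda>\<omega>. exp (- (l * (1 - u)) * W \<omega>)))"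
      by (rule sums_of_real)
    then show ?thesis
      using F_sums[of "of_real u"] that by (auto simp: sums_iff)
  qed
  have G_real: "G (of_real u) = of_real (c / (c + (l * (1 - u)) powr \<nu>))" if "0 \<le> u" "u < 1" for u
    using that l powr_of_real[of "1 - u" \<nu>] by (simp add: G_def powr_mult)
  have small: "F z - G z = 0" if "z \<in> of_real ` {0<..<1/2}" for z
  proof -
    from that obtain u where u: "z = of_real u" "0 < u" "u < 1 / 2"
      by auto
    have "c powr (1 / \<nu>) < l / 2"
      using s by (simp add: l_def)
    also have "l / 2 < l * (1 - u)"
      using u l by simp
    finally have "(c powr (1 / \<nu>)) powr \<nu> < (l * (1 - u)) powr \<nu>"
      using \<nu> by (intro powr_less_mono2) auto
    then have "c < (l * (1 - u)) powr \<nu>"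
      using \<nu> c by (simp add: powr_powr)
    then have "expectation (\<lambda>\<omega>. exp (- (l * (1 - u)) * W \<omega>)) = c / (c + (l * (1 - u)) powr \<nu>)"
      using u l c \<nu> pos surv by (intro laplace_mittag_leffler_survival_large) auto
    then show ?thesis
      using u F_real[of u] G_real[of u] by simp
  qed
  \<comment> \<open>The identity theorem needs agreement on a set accumulating inside the disc; here
    the real segment accumulates at 0. The shift by 3 keeps every \<open>1 / (real n + 3)\<close>
    strictly below 1/2.\<close>
  have limpt: "(0::complex) islimpt of_real ` {0<..<1/2}"
    unfolding islimpt_sequential
  proof (intro exI conjI allI)
    show "complex_of_real (1 / (real n + 3)) \<in> of_real ` {0<..<1/2} - {0}" for n
    proof -
      have "1 / (real n + 3) \<in> {0<..<1/2}"
        by (simp add: field_simps)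
      then show ?thesis
        by (auto simp del: of_real_divide)
    qed
    have "(\<lambda>n. 1 / (real n + 3)) \<longlonglongrightarrow> 0"
      by real_asymp
    then show "(\<lambda>n. complex_of_real (1 / (real n + 3))) \<longlonglongrightarrow> 0"
      by (subst of_real_0[symmetric]) (rule tendsto_of_real)
  qed
  define u where "u = 1 - s / l"
  have u: "0 \<le> u" "u < 1" "l * (1 - u) = s"
    using l s by (auto simp: u_def)
  have "F (of_real u) - G (of_real u) = 0"
  proof (rule analytic_continuation[where f = "\<lambda>z. F z - G z", OF _ _ _ _ _ limpt small])
    show "(\<lambda>z. F z - G z) holomorphic_on ball 0 1"
      by (intro holomorphic_intros holF holG)
  qed (use u in auto)
  then show ?thesis
    using F_real[of u] G_real[of u] u by (simp flip: of_real_add of_real_divide)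
qed

section \<open>Generating functions of distributions on the natural numbers\<close>

lemma sums_pgf:
  fixes M :: "nat measure" and u :: real
  assumes "prob_space M" and sets: "sets M = UNIV" and u: "0 \<le> u" "u < 1"
  shows "(\<lambda>n. measure M {n} * u ^ n) sums (\<integral>n. u ^ n \<partial>M)"
proof -
  interpret prob_space M by fact
  have space: "space M = UNIV"
    using sets_eq_imp_space_eq[of M "count_space UNIV"] sets by simp
  have [measurable_cong]: "sets M = sets (count_space UNIV)"
    using sets by simp
  have single: "(\<lambda>n. indicator {n} x * u ^ n) sums u ^ x" for x :: nat
    using sums_single[of x "\<lambda>n. u ^ n"]
    by (rule sums_cong[THEN iffD1, rotated]) (simp add: indicator_def)
  have eq: "(\<integral>x. indicator {n} x * u ^ n \<partial>M) = prob {n} * u ^ n" for n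
    using space by simp
  have "(\<lambda>n. \<integral>x. indicator {n} x * u ^ n \<partial>M) sums
      (\<integral>x. (\<Sum>n. indicator {n} x * u ^ n) \<partial>M)"
  proof (rule sums_integral)
    show "integrable M (\<lambda>x. indicator {n} x * u ^ n)" for n
      using u by (intro integrable_const_bound[where B = 1] AE_I2)
        (auto simp: indicator_def power_le_one)
    show "AE x in M. summable (\<lambda>n. norm (indicator {n} x * u ^ n))"
      using single u by (intro AE_I2) (auto simp: abs_mult sums_iff)
    have "(\<integral>x. norm (indicator {n} x * u ^ n) \<partial>M) = prob {n} * u ^ n" for n
      using eq[of n] u by (simp add: abs_mult)
    moreover have "summable (\<lambda>n. prob {n} * u ^ n)"
      using u by (intro summable_comparison_test'[OF summable_geometric[of u]])
        (auto simp: abs_mult intro!: mult_left_le_one_le)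
    ultimately show "summable (\<lambda>n. \<integral>x. norm (indicator {n} x * u ^ n) \<partial>M)"
      by simp
  qed
  then show ?thesis
    using single by (simp add: eq sums_iff)
qed

text \<open>The difference of the generating functions is a power series with coefficients bounded
  by 1 that vanishes on [0,1). A nonzero coefficient would make its zero at 0 isolated, which is
  impossible.\<close>

lemma pgf_unique:
  fixes P Q :: "nat measure"
  assumes "prob_space P" "prob_space Q" and sets: "sets P = UNIV" "sets Q = UNIV"
    and pgf: "\<And>u::real. 0 \<le> u \<Longrightarrow> u < 1 \<Longrightarrow> (\<integral>n. u ^ n \<partial>P) = (\<integral>n. u ^ n \<partial>Q)"
  shows "P = Q"
proof -
  interpret P: prob_space P by fact
  interpret Q: prob_space Q by fact
  define a where "a n = measure P {n} - measure Q {n}" for n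
  have zero: "(\<lambda>n. a n * u ^ n) sums 0" if "0 \<le> u" "u < 1" for u
    using sums_diff[OF sums_pgf[OF assms(1) sets(1) that] sums_pgf[OF assms(2) sets(2) that]] pgf[OF that]
    by (simp add: a_def algebra_simps)
  have "\<bar>a n\<bar> \<le> 1" for n
    using P.prob_le_1[of "{n}"] Q.prob_le_1[of "{n}"]
      measure_nonneg[of P "{n}"] measure_nonneg[of Q "{n}"] unfolding a_def by linarith
  then have sums: "(\<lambda>n. a n * x ^ n) sums (\<Sum>n. a n * x ^ n)" if "\<bar>x\<bar> < 1" for x
    using that
    by (intro summable_sums summable_comparison_test'[OF summable_geometric[of "\<bar>x\<bar>"]])
      (auto simp: abs_mult power_abs intro!: mult_left_le_one_le)
  have f0: "(\<Sum>n. a n * 0 ^ n) = 0"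
    using zero[of 0] by (simp only: sums_iff)
  have a0: "a 0 = 0"
    using f0 by simp
  have "a m = 0" for m
  proof (rule ccontr)
    assume m: "a m \<noteq> 0"
    then have "0 < m"
      using a0 by (cases m) auto
    then obtain s where s: "0 < s" "\<And>z. z \<in> cball 0 s - {0} \<Longrightarrow> (\<Sum>n. a n * z ^ n) \<noteq> 0"
      using powser_0_nonzero[where r = 1 and \<xi> = 0 and a = a and f = "\<lambda>x. \<Sum>n. a n * x ^ n" and m = m]
        sums m f0 by auto
    \<comment> \<open>A point of the zero-free punctured disc that also lies in [0,1), where the
      series is known to vanish.\<close>
    define z where "z = min s (1 / 2)"
    have "z \<in> cball 0 s - {0}" "0 \<le> z" "z < 1"
      using s(1) by (auto simp: z_def)
    then show False
      using s(2) zero[of z] by (auto simp: sums_iff)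
  qed
  then have eq: "measure P {n} = measure Q {n}" for n
    by (simp add: a_def)
  show ?thesis
  proof (rule measure_eqI_countable[of _ UNIV])
    show "emeasure P {n} = emeasure Q {n}" for n
      by (simp add: P.emeasure_eq_measure Q.emeasure_eq_measure eq)
  qed (use sets in auto)
qed

section \<open>Poisson process at fixed and at random times\<close>

lemma pgf_poisson_pmf:
  fixes u r :: real
  assumes "0 < r" "0 \<le> u" "u < 1"
  shows "(\<integral>n. u ^ n \<partial>measure_pmf (poisson_pmf r)) = exp (- (r * (1 - u)))"
proof -
  have "(\<lambda>n. exp (- r) * ((r * u) ^ n /\<^sub>R fact n)) sums (exp (- r) * exp (r * u))"
    by (intro sums_mult exp_converges)
  moreover have "exp (- r) * exp (r * u) = exp (- (r * (1 - u)))"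
    by (simp add: mult_exp_exp algebra_simps)
  moreover have "exp (- r) * ((r * u) ^ n /\<^sub>R fact n) =
      measure (measure_pmf (poisson_pmf r)) {n} * u ^ n" for n
    using assms by (simp add: measure_pmf_single divide_inverse power_mult_distrib)
  ultimately show ?thesis
    using sums_pgf[OF measure_pmf.prob_space_axioms, of "poisson_pmf r" u] assms by (simp add: sums_iff)
qed

text \<open>Only laws of increments are given; \<open>N t\<close> is the increment from time 0
  because every path starts at 0.\<close>

lemma (in prob_space) pgf_poisson_process:
  fixes u :: real
  assumes "poisson_process r N" "0 < r" "0 < t" "0 \<le> u" "u < 1"
  shows "expectation (\<lambda>\<omega>. u ^ N t \<omega>) = exp (- (r * (1 - u)) * t)"
proof -
  have [measurable]: "random_variable (count_space UNIV) (N t)"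
    using assms by (auto simp: poisson_process_def)
  have "distr M (count_space UNIV) (N t) = distr M (count_space UNIV) (\<lambda>\<omega>. N t \<omega> - N 0 \<omega>)"
    using assms by (intro distr_cong) (auto simp: poisson_process_def)
  also have "\<dots> = measure_pmf (poisson_pmf (r * (t - 0)))"
    using assms unfolding poisson_process_def by blast
  finally have distr: "distr M (count_space UNIV) (N t) = measure_pmf (poisson_pmf (r * t))"
    by simp
  have "expectation (\<lambda>\<omega>. u ^ N t \<omega>) = (\<integral>n. u ^ n \<partial>distr M (count_space UNIV) (N t))"
    by (subst integral_distr) auto
  then show ?thesis
    unfolding distr using assms by (simp add: pgf_poisson_pmf mult_ac)
qed

text \<open>Split over the values \<open>j\<close> of \<open>D\<close> and apply the product formula
  on each event \<open>D \<omega> = j\<close>. On the right the inner expectation treats the index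
  \<open>D \<omega>\<close> as frozen and averages over a fresh sample point.\<close>

lemma (in prob_space) expectation_at_discrete_random_index:
  fixes g :: "nat \<Rightarrow> 'a \<Rightarrow> real"
  assumes D[measurable]: "random_variable (count_space UNIV) D"
    and g[measurable]: "\<And>j. random_variable borel (g j)"
    and bound: "\<And>j \<omega>. 0 \<le> g j \<omega>" "\<And>j \<omega>. g j \<omega> \<le> 1"
    and indep: "\<And>j. expectation (\<lambda>\<omega>. g j \<omega> * indicator {j} (D \<omega>)) =
                    expectation (g j) * expectation (\<lambda>\<omega>. indicator {j} (D \<omega>))"
  shows "expectation (\<lambda>\<omega>. g (D \<omega>) \<omega>) = expectation (\<lambda>\<omega>. expectation (g (D \<omega>)))"
proof -
  have [measurable]: "(\<lambda>\<omega>. indicator {j} (D \<omega>) :: real) \<in> borel_measurable M" for j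
    by (rule measurable_compose[OF D]) simp
  have nn: "(\<integral>\<^sup>+\<omega>. ennreal (h (D \<omega>) \<omega>) \<partial>M) =
      (\<Sum>j. ennreal (expectation (\<lambda>\<omega>. h j \<omega> * indicator {j} (D \<omega>))))"
    if [measurable]: "\<And>j. random_variable borel (h j)"
      and b: "\<And>j \<omega>. 0 \<le> h j \<omega>" "\<And>j \<omega>. h j \<omega> \<le> 1"
    for h :: "nat \<Rightarrow> 'a \<Rightarrow> real"
  proof -
    have "(\<Sum>j. ennreal (h j \<omega> * indicator {j} (D \<omega>))) = ennreal (h (D \<omega>) \<omega>)" for \<omega>
      by (subst suminf_finite[of "{D \<omega>}"]) auto
    then have "(\<integral>\<^sup>+\<omega>. ennreal (h (D \<omega>) \<omega>) \<partial>M) =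
        (\<integral>\<^sup>+\<omega>. (\<Sum>j. ennreal (h j \<omega> * indicator {j} (D \<omega>))) \<partial>M)"
      by simp
    also have "\<dots> = (\<Sum>j. \<integral>\<^sup>+\<omega>. ennreal (h j \<omega> * indicator {j} (D \<omega>)) \<partial>M)"
      by (rule nn_integral_suminf) measurable
    also have "\<dots> = (\<Sum>j. ennreal (expectation (\<lambda>\<omega>. h j \<omega> * indicator {j} (D \<omega>))))"
      using b by (intro suminf_cong nn_integral_eq_integral integrable_const_bound[where B = 1] AE_I2)
        (auto simp: indicator_def)
    finally show ?thesis .
  qed
  have g1: "integrable M (g j)" for j
    using bound by (intro integrable_const_bound[where B = 1] AE_I2) auto
  have e: "0 \<le> expectation (g j)" "expectation (g j) \<le> 1" for j
    using bound g1 by (auto intro!: integral_nonneg_AE integral_le_const)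
  have m: "(\<lambda>\<omega>. g (D \<omega>) \<omega>) \<in> borel_measurable M"
    by (rule measurable_compose_countable) measurable
  \<comment> \<open>\<open>nn\<close> is used for \<open>g\<close> and for the constants
    \<open>expectation (g j)\<close>; the two resulting series agree term by term.\<close>
  have "(\<integral>\<^sup>+\<omega>. ennreal (g (D \<omega>) \<omega>) \<partial>M) = (\<integral>\<^sup>+\<omega>. ennreal (expectation (g (D \<omega>))) \<partial>M)"
  proof -
    have "expectation (\<lambda>\<omega>. g j \<omega> * indicator {j} (D \<omega>)) =
        expectation (\<lambda>\<omega>. expectation (g j) * indicator {j} (D \<omega>))" for j
      unfolding indep by (rule integral_mult_right_zero[symmetric])
    then show ?thesis
      using nn[of g, OF g bound] nn[of "\<lambda>j _. expectation (g j)", OF _ e]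
      by (simp only: borel_measurable_const)
  qed
  moreover have "expectation (\<lambda>\<omega>. g (D \<omega>) \<omega>) = enn2real (\<integral>\<^sup>+\<omega>. ennreal (g (D \<omega>) \<omega>) \<partial>M)"
    using m bound by (intro integral_eq_nn_integral AE_I2)
  moreover have "expectation (\<lambda>\<omega>. expectation (g (D \<omega>))) =
      enn2real (\<integral>\<^sup>+\<omega>. ennreal (expectation (g (D \<omega>))) \<partial>M)"
    using e by (intro integral_eq_nn_integral AE_I2) measurable
  ultimately show ?thesis
    by (simp only:)
qed

text \<open>The sequence consists of the right endpoints of the dyadic cells containing
  \<open>x\<close>. The \<open>+ 1\<close> makes them strictly larger than \<open>x\<close>, as
  \<open>at_right\<close> demands, and their distance to \<open>x\<close> is at most the cell
  length.\<close>

lemma filterlim_dyadic_at_right: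
  fixes x :: real
  assumes "0 \<le> x"
  shows "filterlim (\<lambda>m. (real (nat \<lfloor>2 ^ m * x\<rfloor>) + 1) / 2 ^ m) (at_right x) sequentially"
proof (rule tendsto_imp_filterlim_at_right)
  have bnd: "x < (real (nat \<lfloor>2 ^ m * x\<rfloor>) + 1) / 2 ^ m"
    "(real (nat \<lfloor>2 ^ m * x\<rfloor>) + 1) / 2 ^ m \<le> x + (1 / 2) ^ m" for m
  proof -
    have "real (nat \<lfloor>2 ^ m * x\<rfloor>) = of_int \<lfloor>2 ^ m * x\<rfloor>"
      using assms by simp
    moreover have "2 ^ m * x < of_int \<lfloor>2 ^ m * x\<rfloor> + 1" "of_int \<lfloor>2 ^ m * x\<rfloor> \<le> 2 ^ m * x"
      by linarith+
    ultimately have *: "x * 2 ^ m < real (nat \<lfloor>2 ^ m * x\<rfloor>) + 1"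
      "real (nat \<lfloor>2 ^ m * x\<rfloor>) + 1 \<le> 2 ^ m * x + 1"
      by (simp_all only: mult.commute add_le_cancel_right)
    show "x < (real (nat \<lfloor>2 ^ m * x\<rfloor>) + 1) / 2 ^ m"
      using *(1) by (subst pos_less_divide_eq) auto
    have "(real (nat \<lfloor>2 ^ m * x\<rfloor>) + 1) / 2 ^ m \<le> (2 ^ m * x + 1) / 2 ^ m"
      using *(2) by (rule divide_right_mono) simp
    then show "(real (nat \<lfloor>2 ^ m * x\<rfloor>) + 1) / 2 ^ m \<le> x + (1 / 2) ^ m"
      by (simp add: add_divide_distrib power_one_over)
  qed
  have lim: "(\<lambda>m. x + (1 / 2) ^ m) \<longlonglongrightarrow> x"
    using tendsto_add[OF tendsto_const LIMSEQ_power_zero[of "1 / 2 :: real"], of x] by simp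
  have lower: "\<forall>\<^sub>F m in sequentially. x \<le> (real (nat \<lfloor>2 ^ m * x\<rfloor>) + 1) / 2 ^ m"
    by (rule always_eventually, rule allI, rule less_imp_le, rule bnd(1))
  have upper: "\<forall>\<^sub>F m in sequentially. (real (nat \<lfloor>2 ^ m * x\<rfloor>) + 1) / 2 ^ m \<le> x + (1 / 2) ^ m"
    by (rule always_eventually, rule allI, rule bnd(2))
  show "(\<lambda>m. (real (nat \<lfloor>2 ^ m * x\<rfloor>) + 1) / 2 ^ m) \<longlonglongrightarrow> x"
    by (rule real_tendsto_sandwich[OF lower upper tendsto_const lim])
  show "\<forall>\<^sub>F m in sequentially. x < (real (nat \<lfloor>2 ^ m * x\<rfloor>) + 1) / 2 ^ m"
    by (rule always_eventually, rule allI, rule bnd(1))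
qed

text \<open>Translates events of the discretised time into half-open intervals, the form
  \<open>{a..<b}\<close> in which independence is supplied later.\<close>

lemma nat_floor_dyadic_eq_iff:
  assumes "0 \<le> (x::real)"
  shows "nat \<lfloor>2 ^ m * x\<rfloor> = j \<longleftrightarrow> real j / 2 ^ m \<le> x \<and> x < (real j + 1) / 2 ^ m"
proof -
  have "0 \<le> \<lfloor>2 ^ m * x\<rfloor>"
    using assms by simp
  then have "nat \<lfloor>2 ^ m * x\<rfloor> = j \<longleftrightarrow> \<lfloor>2 ^ m * x\<rfloor> = int j"
    by linarith
  also have "\<dots> \<longleftrightarrow> real j \<le> x * 2 ^ m \<and> x * 2 ^ m < real j + 1"
    by (simp add: floor_eq_iff mult.commute[of x])
  also have "\<dots> \<longleftrightarrow> real j / 2 ^ m \<le> x \<and> x < (real j + 1) / 2 ^ m"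
    by (subst pos_less_divide_eq, simp, subst pos_divide_le_eq, simp_all)
  finally show ?thesis .
qed

text \<open>
  The random time is approximated from the right by dyadic times, so that independence is only
  needed for single times of the Poisson process.
\<close>

lemma (in prob_space)
  fixes u :: real
  assumes pp: "poisson_process r N" and r: "0 < r"
    and T[measurable]: "random_variable borel T" and T0: "\<And>\<omega>. \<omega> \<in> space M \<Longrightarrow> 0 \<le> T \<omega>"
  shows measurable_poisson_process_random_time:
      "random_variable (count_space UNIV) (\<lambda>\<omega>. N (T \<omega>) \<omega>)"
    and pgf_poisson_process_random_time:
      "\<lbrakk>\<And>t a b. 0 \<le> t \<Longrightarrow> 0 \<le> a \<Longrightarrow> a < b \<Longrightarrow>
          expectation (\<lambda>\<omega>. u ^ N t \<omega> * indicator {a..<b} (T \<omega>)) =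
          expectation (\<lambda>\<omega>. u ^ N t \<omega>) * expectation (\<lambda>\<omega>. indicator {a..<b} (T \<omega>));
        0 \<le> u; u < 1\<rbrakk> \<Longrightarrow>
        expectation (\<lambda>\<omega>. u ^ N (T \<omega>) \<omega>) = expectation (\<lambda>\<omega>. exp (- (r * (1 - u)) * T \<omega>))"
proof -
  define D where "D m \<omega> = nat \<lfloor>2 ^ m * T \<omega>\<rfloor>" for m :: nat and \<omega>
  define t where "t m j = (real j + 1) / 2 ^ m" for m j :: nat
  have t0: "0 < t m j" for m j
    by (simp add: t_def)
  have [measurable]: "random_variable (count_space UNIV) (D m)" for m
    unfolding D_def by measurable
  have N[measurable]: "random_variable (count_space UNIV) (N (t m j))" for m j
    using pp t0[of m j] by (auto simp: poisson_process_def less_imp_le)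
  have lim_t: "filterlim (\<lambda>m. t m (D m \<omega>)) (at_right (T \<omega>)) sequentially"
    if "\<omega> \<in> space M" for \<omega>
    using filterlim_dyadic_at_right[OF T0[OF that]] by (simp add: t_def D_def)
  have lim_N: "\<forall>\<^sub>F m in sequentially. N (t m (D m \<omega>)) \<omega> = N (T \<omega>) \<omega>" if "\<omega> \<in> space M" for \<omega>
  proof -
    have "continuous (at_right (T \<omega>)) (\<lambda>s. N s \<omega>)"
      using pp T0 that by (auto simp: poisson_process_def)
    then have "((\<lambda>s. N s \<omega>) \<longlongrightarrow> N (T \<omega>) \<omega>) (at_right (T \<omega>))"
      by (simp add: continuous_within)
    \<comment> \<open>The values are natural numbers, so convergence along the dyadic times means
      being eventually equal to the limit.\<close>
    then show ?thesis
      unfolding tendsto_discrete[symmetric] using lim_t[OF that] by (rule filterlim_compose)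
  qed
  have meas_ND: "random_variable (count_space UNIV) (\<lambda>\<omega>. N (t m (D m \<omega>)) \<omega>)" for m
    by (rule measurable_compose_countable) measurable
  have "(\<lambda>\<omega>. real (N (T \<omega>) \<omega>)) \<in> borel_measurable M"
  proof (rule borel_measurable_LIMSEQ_metric)
    show "(\<lambda>\<omega>. real (N (t m (D m \<omega>)) \<omega>)) \<in> borel_measurable M" for m
      by (rule measurable_compose[OF meas_ND]) simp
    show "(\<lambda>m. real (N (t m (D m \<omega>)) \<omega>)) \<longlonglongrightarrow> real (N (T \<omega>) \<omega>)" if "\<omega> \<in> space M" for \<omega>
      using lim_N[OF that] by (intro tendsto_eventually) (auto elim: eventually_mono)
  qed
  \<comment> \<open>The limit was taken in the reals;
    \<open>nat \<lfloor>real n\<rfloor> = n\<close> brings measurability back to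
    \<open>nat\<close>.\<close>
  moreover have "(\<lambda>x::real. nat \<lfloor>x\<rfloor>) \<in> borel \<rightarrow>\<^sub>M count_space UNIV"
    by measurable
  ultimately have "random_variable (count_space UNIV) (\<lambda>\<omega>. nat \<lfloor>real (N (T \<omega>) \<omega>)\<rfloor>)"
    by (rule measurable_compose)
  then show meas: "random_variable (count_space UNIV) (\<lambda>\<omega>. N (T \<omega>) \<omega>)"
    by simp
  show "expectation (\<lambda>\<omega>. u ^ N (T \<omega>) \<omega>) = expectation (\<lambda>\<omega>. exp (- (r * (1 - u)) * T \<omega>))"
    if indep: "\<And>t a b. 0 \<le> t \<Longrightarrow> 0 \<le> a \<Longrightarrow> a < b \<Longrightarrow>
          expectation (\<lambda>\<omega>. u ^ N t \<omega> * indicator {a..<b} (T \<omega>)) =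
          expectation (\<lambda>\<omega>. u ^ N t \<omega>) * expectation (\<lambda>\<omega>. indicator {a..<b} (T \<omega>))"
      and u: "0 \<le> u" "u < 1"
  proof -
    have discrete: "expectation (\<lambda>\<omega>. u ^ N (t m (D m \<omega>)) \<omega>) =
        expectation (\<lambda>\<omega>. exp (- (r * (1 - u)) * t m (D m \<omega>)))" for m
    proof -
      have ind: "(indicator {j} (D m \<omega>) :: real) = indicator {real j / 2 ^ m..<(real j + 1) / 2 ^ m} (T \<omega>)"
        if "\<omega> \<in> space M" for j \<omega>
        using nat_floor_dyadic_eq_iff[OF T0[OF that], of m j] by (simp add: D_def indicator_def)
      have "expectation (\<lambda>\<omega>. u ^ N (t m j) \<omega> * indicator {j} (D m \<omega>)) =
          expectation (\<lambda>\<omega>. u ^ N (t m j) \<omega>) * expectation (\<lambda>\<omega>. indicator {j} (D m \<omega>))" for j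
      proof -
        have "expectation (\<lambda>\<omega>. u ^ N (t m j) \<omega> * indicator {j} (D m \<omega>)) =
            expectation (\<lambda>\<omega>. u ^ N (t m j) \<omega> *
              indicator {real j / 2 ^ m..<(real j + 1) / 2 ^ m} (T \<omega>))"
          by (intro Bochner_Integration.integral_cong refl) (simp only: ind)
        also have "\<dots> = expectation (\<lambda>\<omega>. u ^ N (t m j) \<omega>) *
            expectation (\<lambda>\<omega>. indicator {real j / 2 ^ m..<(real j + 1) / 2 ^ m} (T \<omega>))"
          using t0[of m j] by (intro indep) (auto simp: divide_strict_right_mono)
        also have "expectation (\<lambda>\<omega>. indicator {real j / 2 ^ m..<(real j + 1) / 2 ^ m} (T \<omega>) :: real) =
            expectation (\<lambda>\<omega>. indicator {j} (D m \<omega>))"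
          by (intro Bochner_Integration.integral_cong refl) (simp only: ind)
        finally show ?thesis .
      qed
      then have "expectation (\<lambda>\<omega>. u ^ N (t m (D m \<omega>)) \<omega>) =
          expectation (\<lambda>\<omega>. expectation (\<lambda>\<omega>'. u ^ N (t m (D m \<omega>)) \<omega>'))"
        using u by (intro expectation_at_discrete_random_index[where g = "\<lambda>j \<omega>. u ^ N (t m j) \<omega>"])
          (auto simp: power_le_one)
      then show ?thesis
        using pgf_poisson_process[OF pp r t0 u] by simp
    qed
    \<comment> \<open>Both sides of \<open>discrete\<close> pass to the limit with dominating
      constant 1: the left integrand is eventually constant for each sample point, the right one
      converges by continuity of \<open>exp\<close>.\<close>
    have "(\<lambda>m. expectation (\<lambda>\<omega>. u ^ N (t m (D m \<omega>)) \<omega>)) \<longlonglongrightarrow> expectation (\<lambda>\<omega>. u ^ N (T \<omega>) \<omega>)"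
    proof (rule integral_dominated_convergence[where w = "\<lambda>_. 1"])
      show "AE \<omega> in M. (\<lambda>m. u ^ N (t m (D m \<omega>)) \<omega>) \<longlonglongrightarrow> u ^ N (T \<omega>) \<omega>"
      proof (rule AE_I2)
        fix \<omega> assume "\<omega> \<in> space M"
        from lim_N[OF this] show "(\<lambda>m. u ^ N (t m (D m \<omega>)) \<omega>) \<longlonglongrightarrow> u ^ N (T \<omega>) \<omega>"
          by (intro tendsto_eventually) (auto elim: eventually_mono)
      qed
      show "(\<lambda>\<omega>. u ^ N (T \<omega>) \<omega>) \<in> borel_measurable M"
        by (rule measurable_compose[OF meas]) simp
      show "(\<lambda>\<omega>. u ^ N (t m (D m \<omega>)) \<omega>) \<in> borel_measurable M" for m
        by (rule measurable_compose[OF meas_ND]) simp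
      show "AE \<omega> in M. norm (u ^ N (t m (D m \<omega>)) \<omega>) \<le> 1" for m
        using u by (intro AE_I2) (simp add: power_le_one)
    qed simp
    moreover have "(\<lambda>m. expectation (\<lambda>\<omega>. exp (- (r * (1 - u)) * t m (D m \<omega>)))) \<longlonglongrightarrow>
        expectation (\<lambda>\<omega>. exp (- (r * (1 - u)) * T \<omega>))"
    proof (rule integral_dominated_convergence[where w = "\<lambda>_. 1"])
      show "AE \<omega> in M. (\<lambda>m. exp (- (r * (1 - u)) * t m (D m \<omega>))) \<longlonglongrightarrow> exp (- (r * (1 - u)) * T \<omega>)"
      proof (rule AE_I2)
        fix \<omega> assume "\<omega> \<in> space M"
        then have "(\<lambda>m. t m (D m \<omega>)) \<longlonglongrightarrow> T \<omega>"
          using lim_t by (auto simp: filterlim_at)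
        then show "(\<lambda>m. exp (- (r * (1 - u)) * t m (D m \<omega>))) \<longlonglongrightarrow> exp (- (r * (1 - u)) * T \<omega>)"
          by (intro tendsto_intros)
      qed
      show "AE \<omega> in M. norm (exp (- (r * (1 - u)) * t m (D m \<omega>))) \<le> 1" for m
        using u r t0[of m] by (intro AE_I2) (auto simp: less_imp_le)
    qed auto
    ultimately show ?thesis
      unfolding discrete by (rule LIMSEQ_unique)
  qed
qed

section \<open>Arrival times of the renewal process and their dependence on the path\<close>

text \<open>
  Boundedness of \<open>S\<close> is allowed: if infinitely many \<open>S n\<close> are at most \<open>t\<close>, then \<^const>\<open>card\<close> is \<open>0\<close>,
  which differs from \<open>k\<close>. Hence arrivals that accumulate need no exceptional null set below.
\<close>

lemma card_atMost_strict_mono_eq_iff: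
  fixes S :: "nat \<Rightarrow> real"
  assumes S: "strict_mono S" and k: "1 \<le> k"
  shows "card {n. 1 \<le> n \<and> S n \<le> t} = k \<longleftrightarrow> S k \<le> t \<and> t < S (Suc k)"
proof
  define A where "A = {n. 1 \<le> n \<and> S n \<le> t}"
  assume "card {n. 1 \<le> n \<and> S n \<le> t} = k"
  then have card: "card A = k"
    by (simp only: A_def)
  then have fin: "finite A"
    using k by (intro card_ge_0_finite) linarith
  have less: "t < S (Suc k)"
  proof (rule ccontr)
    assume "\<not> t < S (Suc k)"
    then have t: "S (Suc k) \<le> t"
      by (simp only: not_less)
    have "S n \<le> t" if "n \<le> Suc k" for n
    proof -
      have "S n \<le> S (Suc k)"
        using that by (simp only: strict_mono_less_eq[OF S])
      then show ?thesis
        using t by (rule order_trans)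
    qed
    then have "{1..Suc k} \<subseteq> A"
      by (simp add: A_def subset_iff)
    then have "card {1..Suc k} \<le> card A"
      by (rule card_mono[OF fin])
    then show False
      using card by simp
  qed
  have "A \<subseteq> {1..k}"
  proof
    fix n assume "n \<in> A"
    then have "S n < S (Suc k)" "1 \<le> n"
      using less by (auto simp: A_def)
    then show "n \<in> {1..k}"
      using strict_mono_less[OF S, of n "Suc k"] by simp
  qed
  then have "A = {1..k}"
    by (rule card_subset_eq[rotated]) (simp_all add: card)
  then have "k \<in> A"
    using k by simp
  then show "S k \<le> t \<and> t < S (Suc k)"
    using less by (simp add: A_def)
next
  assume t: "S k \<le> t \<and> t < S (Suc k)"
  have eq: "S n \<le> t \<longleftrightarrow> n \<le> k" for n
  proof
    assume "S n \<le> t"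
    then have "S n < S (Suc k)"
      using t by simp
    then show "n \<le> k"
      using strict_mono_less[OF S, of n "Suc k"] by simp
  next
    assume "n \<le> k"
    then have "S n \<le> S k"
      using strict_mono_less_eq[OF S] by simp
    then show "S n \<le> t"
      using t by simp
  qed
  have "{n. 1 \<le> n \<and> S n \<le> t} = {1..k}"
    unfolding eq by auto
  then show "card {n. 1 \<le> n \<and> S n \<le> t} = k"
    by simp
qed

context prob_space
begin

context
  fixes W :: "nat \<Rightarrow> 'a \<Rightarrow> real" and N :: "real \<Rightarrow> 'a \<Rightarrow> nat" and k :: nat and \<omega> :: 'a
  assumes renewal: "renewal_counting_process W N" and \<omega>: "\<omega> \<in> space M" and k: "1 \<le> k"
begin

lemma strict_mono_arrival_time: "strict_mono (\<lambda>n. arrival_time W n \<omega>)"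
proof -
  have "0 < W i \<omega>" for i
    using renewal \<omega> unfolding renewal_counting_process_def by blast
  then show ?thesis
    by (simp add: strict_mono_Suc_iff arrival_time_def)
qed

lemma arrival_time_pos: "0 < arrival_time W k \<omega>"
proof -
  have "arrival_time W 0 \<omega> < arrival_time W k \<omega>"
    using k by (intro strict_monoD[OF strict_mono_arrival_time]) simp
  then show ?thesis
    by (simp add: arrival_time_def)
qed

lemma renewal_count_eq_iff:
  assumes "0 \<le> t"
  shows "N t \<omega> = k \<longleftrightarrow> arrival_time W k \<omega> \<le> t \<and> t < arrival_time W (Suc k) \<omega>"
proof -
  have "N t \<omega> = card {n. 1 \<le> n \<and> arrival_time W n \<omega> \<le> t}"
    using renewal \<omega> assms unfolding renewal_counting_process_def by blast
  then show ?thesis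
    using card_atMost_strict_mono_eq_iff[OF strict_mono_arrival_time k, of t] by (simp only:)
qed

text \<open>The times at which the count equals \<open>k\<close> form the half-open interval between
  the arrivals \<open>k\<close> and \<open>k + 1\<close>. It is nonempty because waiting times are
  positive, so \<open>Inf\<close> is its left endpoint; that endpoint is positive since
  \<open>k \<ge> 1\<close>, so the restriction \<open>0 < t\<close> discards nothing.\<close>

lemma first_time_renewal: "first_time N k \<omega> = arrival_time W k \<omega>"
proof -
  have "{t. 0 < t \<and> N t \<omega> = k} = {arrival_time W k \<omega>..<arrival_time W (Suc k) \<omega>}"
  proof (intro set_eqI iffI)
    fix t assume "t \<in> {t. 0 < t \<and> N t \<omega> = k}"
    then show "t \<in> {arrival_time W k \<omega>..<arrival_time W (Suc k) \<omega>}"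
      using renewal_count_eq_iff[of t] by simp
  next
    fix t assume "t \<in> {arrival_time W k \<omega>..<arrival_time W (Suc k) \<omega>}"
    then show "t \<in> {t. 0 < t \<and> N t \<omega> = k}"
      using renewal_count_eq_iff[of t] arrival_time_pos by simp
  qed
  moreover have "arrival_time W k \<omega> < arrival_time W (Suc k) \<omega>"
    using strict_mono_arrival_time by (simp add: strict_mono_Suc_iff)
  ultimately show ?thesis
    by (simp add: first_time_def)
qed

text \<open>
  Only rational times occur on the right, so the event depends measurably on the path of \<open>N\<close>.
\<close>

lemma arrival_time_less_iff:
  "arrival_time W k \<omega> < b \<longleftrightarrow>
     (\<exists>q::rat. 0 < real_of_rat q \<and> real_of_rat q < b \<and> N (real_of_rat q) \<omega> = k)"
proof
  assume "arrival_time W k \<omega> < b"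
  moreover have "arrival_time W k \<omega> < arrival_time W (Suc k) \<omega>"
    using strict_mono_arrival_time by (simp add: strict_mono_Suc_iff)
  \<comment> \<open>The second bound in \<open>min\<close> keeps \<open>q\<close> before the next
    arrival, where the count is still \<open>k\<close>.\<close>
  ultimately obtain q where q: "arrival_time W k \<omega> < real_of_rat q"
      "real_of_rat q < min b (arrival_time W (Suc k) \<omega>)"
    using of_rat_dense[of "arrival_time W k \<omega>" "min b (arrival_time W (Suc k) \<omega>)"] by auto
  moreover from q have "0 < real_of_rat q"
    using arrival_time_pos by linarith
  ultimately show "\<exists>q::rat. 0 < real_of_rat q \<and> real_of_rat q < b \<and> N (real_of_rat q) \<omega> = k"
    using renewal_count_eq_iff[of "real_of_rat q"] by (intro exI[of _ q]) auto
next
  assume "\<exists>q::rat. 0 < real_of_rat q \<and> real_of_rat q < b \<and> N (real_of_rat q) \<omega> = k"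
  then obtain q :: rat where q: "0 < real_of_rat q" "real_of_rat q < b" "N (real_of_rat q) \<omega> = k"
    by blast
  then show "arrival_time W k \<omega> < b"
    using renewal_count_eq_iff[of "real_of_rat q"] by simp
qed

end

text \<open>Both factors are measurable functionals of whole paths: one evaluates the path of
  \<open>N'\<close> at \<open>t\<close>, the other reads the position of the arrival from the path
  of \<open>N\<close>. Independence of the paths therefore factorises the expectation, as
  \<open>pgf_poisson_process_random_time\<close> requires.\<close>

lemma expectation_pgf_times_arrival_indicator:
  fixes u :: real
  assumes renewal: "renewal_counting_process W N" and k: "1 \<le> k"
    and indep: "indep_processes N' N"
    and u: "0 \<le> u" "u < 1" and t: "0 \<le> t" and ab: "a < b"
  shows "expectation (\<lambda>\<omega>. u ^ N' t \<omega> * indicator {a..<b} (arrival_time W k \<omega>)) =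
    expectation (\<lambda>\<omega>. u ^ N' t \<omega>) * expectation (\<lambda>\<omega>. indicator {a..<b} (arrival_time W k \<omega>))"
proof -
  let ?P = "Pi\<^sub>M {0..} (\<lambda>_. count_space UNIV) :: (real \<Rightarrow> nat) measure"
  \<comment> \<open>\<open>E b\<close> is the path event that arrival \<open>k\<close> occurs before
    \<open>b\<close>. The countable union over rational times puts it in the product
    sigma-algebra.\<close>
  define E where "E b x \<longleftrightarrow>
      (\<exists>q::rat. (0 < real_of_rat q \<and> real_of_rat q < b) \<and> x (real_of_rat q) = k)"
    for b :: real and x :: "real \<Rightarrow> nat"
  have E_meas[measurable]: "Measurable.pred ?P (E b)" for b
    unfolding E_def
  proof (rule pred_intros_countable)
    show "Measurable.pred ?P
        (\<lambda>x. (0 < real_of_rat q \<and> real_of_rat q < b) \<and> x (real_of_rat q) = k)" for q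
    proof (cases "0 < real_of_rat q \<and> real_of_rat q < b")
      case True
      then have "(\<lambda>x. x (real_of_rat q)) \<in> measurable ?P (count_space UNIV)"
        by (intro measurable_component_singleton) simp
      then show ?thesis
        using True by simp
    qed auto
  qed
  let ?f = "\<lambda>x::real \<Rightarrow> nat. u ^ x t"
  \<comment> \<open>The event of arriving in \<open>{a..<b}\<close> is arrival before
    \<open>b\<close> but not before \<open>a\<close>.\<close>
  let ?h = "\<lambda>x::real \<Rightarrow> nat. if E b x \<and> \<not> E a x then 1 else 0 :: real"
  let ?X = "\<lambda>\<omega>. \<lambda>t\<in>{0..}. N' t \<omega>" and ?Y = "\<lambda>\<omega>. \<lambda>t\<in>{0..}. N t \<omega>"
  have comp: "(\<lambda>x. x t) \<in> measurable ?P (count_space UNIV)"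
    using t by (intro measurable_component_singleton) simp
  have f_meas: "?f \<in> borel_measurable ?P"
    by (rule measurable_compose[OF comp]) simp
  have h_meas: "?h \<in> borel_measurable ?P"
    by measurable
  have iv: "indep_var borel (?f \<circ> ?X) borel (?h \<circ> ?Y)"
    using indep unfolding indep_processes_def by (rule indep_var_compose[OF _ f_meas h_meas])
  have intf: "integrable M (?f \<circ> ?X)"
    using u indep_var_rv1[OF iv]
    by (intro integrable_const_bound[where B = 1] AE_I2) (auto simp: power_le_one)
  have inth: "integrable M (?h \<circ> ?Y)"
    using indep_var_rv2[OF iv] by (intro integrable_const_bound[where B = 1] AE_I2) auto
  have h_eq: "(?h \<circ> ?Y) \<omega> = indicator {a..<b} (arrival_time W k \<omega>)" if "\<omega> \<in> space M" for \<omega>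
  proof -
    \<comment> \<open>\<open>E\<close> inspects positive times only, so restricting the path to
      \<open>{0..}\<close> does not change it.\<close>
    have E: "E c (?Y \<omega>) \<longleftrightarrow> arrival_time W k \<omega> < c" for c
      unfolding arrival_time_less_iff[OF renewal that k] E_def
      by (intro arg_cong[where f = Ex] ext conj_assoc[THEN trans] conj_cong refl) simp
    show ?thesis
      unfolding o_apply E using ab by (simp add: indicator_def not_less conj_commute)
  qed
  have f_eq: "(?f \<circ> ?X) \<omega> = u ^ N' t \<omega>" for \<omega>
    using t by simp
  have "expectation (\<lambda>\<omega>. (?f \<circ> ?X) \<omega> * (?h \<circ> ?Y) \<omega>) =
      expectation (?f \<circ> ?X) * expectation (?h \<circ> ?Y)"
    by (rule indep_var_lebesgue_integral[OF iv intf inth])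
  also have "expectation (\<lambda>\<omega>. (?f \<circ> ?X) \<omega> * (?h \<circ> ?Y) \<omega>) =
      expectation (\<lambda>\<omega>. u ^ N' t \<omega> * indicator {a..<b} (arrival_time W k \<omega>))"
    by (intro Bochner_Integration.integral_cong refl) (simp only: f_eq h_eq)
  also have "expectation (?f \<circ> ?X) = expectation (\<lambda>\<omega>. u ^ N' t \<omega>)"
    by (intro Bochner_Integration.integral_cong refl f_eq)
  also have "expectation (?h \<circ> ?Y) = expectation (\<lambda>\<omega>. indicator {a..<b} (arrival_time W k \<omega>))"
    by (intro Bochner_Integration.integral_cong refl h_eq)
  finally show ?thesis .
qed

lemma laplace_arrival_time:
  assumes renewal: "renewal_counting_process W N"
    and surv: "\<And>i t. 0 \<le> t \<Longrightarrow>
      prob {\<omega> \<in> space M. t < W i \<omega>} = mittag_leffler \<nu> 1 (- c * t powr \<nu>)"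
    and "0 < \<nu>" "\<nu> \<le> 1" "0 < c" "0 < s"
  shows "expectation (\<lambda>\<omega>. exp (- s * arrival_time W k \<omega>)) = (c / (c + s powr \<nu>)) ^ k"
proof -
  have indep: "indep_vars (\<lambda>_. borel) W UNIV"
    and pos: "\<And>i \<omega>. \<omega> \<in> space M \<Longrightarrow> 0 < W i \<omega>"
    using renewal unfolding renewal_counting_process_def by blast+
  have rv: "random_variable borel (W i)" for i
    using indep by (auto simp: indep_vars_def)
  have indep': "indep_vars (\<lambda>_. borel) (\<lambda>i \<omega>. exp (- s * W i \<omega>)) {..<k}"
    by (rule indep_vars_compose2[where Y = "\<lambda>_ x. exp (- s * x)",
          OF indep_vars_subset[OF indep subset_UNIV]]) measurable
  have int: "integrable M (\<lambda>\<omega>. exp (- s * W i \<omega>))" for i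
    using assms pos rv by (intro integrable_const_bound[where B = 1] AE_I2) (auto simp: less_imp_le)
  have "expectation (\<lambda>\<omega>. exp (- s * arrival_time W k \<omega>)) =
      expectation (\<lambda>\<omega>. \<Prod>i<k. exp (- s * W i \<omega>))"
    by (simp add: arrival_time_def sum_distrib_left exp_sum flip: sum_negf)
  also have "\<dots> = (\<Prod>i<k. expectation (\<lambda>\<omega>. exp (- s * W i \<omega>)))"
    using int by (intro indep_vars_lebesgue_integral indep') auto
  also have "\<dots> = (\<Prod>i<k. c / (c + s powr \<nu>))"
    using assms pos rv by (intro prod.cong refl laplace_mittag_leffler_survival) auto
  finally show ?thesis
    by simp
qed

section \<open>Sums of discrete Mittag-Leffler variables and the equality in law\<close>

text \<open>For real \<open>u < 1\<close> the base \<open>1 - u\<close> is positive, so the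
  principal complex power reduces to the real one.\<close>

lemma pgf_discrete_mittag_leffler:
  fixes u :: real
  assumes "discrete_mittag_leffler \<nu> c X" "0 \<le> u" "u < 1"
  shows "expectation (\<lambda>\<omega>. u ^ X \<omega>) = 1 / (1 + c * (1 - u) powr \<nu>)"
proof -
  have "complex_of_real (expectation (\<lambda>\<omega>. u ^ X \<omega>)) = expectation (\<lambda>\<omega>. complex_of_real u ^ X \<omega>)"
    by (simp flip: integral_complex_of_real)
  also have "\<dots> = inverse (1 + complex_of_real c * (1 - complex_of_real u) powr complex_of_real \<nu>)"
    using assms by (simp add: discrete_mittag_leffler_def)
  also have "(1 - complex_of_real u) powr complex_of_real \<nu> = complex_of_real ((1 - u) powr \<nu>)"
    using powr_of_real[of "1 - u" \<nu>] assms by simp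
  finally have "complex_of_real (expectation (\<lambda>\<omega>. u ^ X \<omega>)) =
      complex_of_real (1 / (1 + c * (1 - u) powr \<nu>))"
    by (simp add: inverse_eq_divide)
  then show ?thesis
    by (simp only: of_real_eq_iff)
qed

lemma pgf_sum_indep:
  fixes u :: real
  assumes indep: "indep_vars (\<lambda>_. count_space UNIV) \<xi> I" and I: "finite I"
    and u: "0 \<le> u" "u < 1"
  shows "expectation (\<lambda>\<omega>. u ^ (\<Sum>j\<in>I. \<xi> j \<omega>)) = (\<Prod>j\<in>I. expectation (\<lambda>\<omega>. u ^ \<xi> j \<omega>))"
proof -
  have indep': "indep_vars (\<lambda>_. borel) (\<lambda>j \<omega>. u ^ \<xi> j \<omega>) I"
    by (rule indep_vars_compose2[where Y = "\<lambda>_ n. u ^ n", OF indep]) simp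
  have "integrable M (\<lambda>\<omega>. u ^ \<xi> j \<omega>)" if "j \<in> I" for j
    using u indep' that unfolding indep_vars_def
    by (intro integrable_const_bound[where B = 1] AE_I2) (auto simp: power_le_one)
  then show ?thesis
    unfolding power_sum by (intro indep_vars_lebesgue_integral I indep')
qed

end

theorem mainTheorem8:
  fixes M :: "'a measure" and M' :: "'b measure"
    and \<nu> rate\<^sub>\<alpha> rate\<^sub>\<beta> :: real
    and N N\<^sub>\<alpha> :: "real \<Rightarrow> 'a \<Rightarrow> nat"
    and \<xi> :: "nat \<Rightarrow> 'b \<Rightarrow> nat" and k :: nat
  assumes "prob_space M" and "prob_space M'"
    and "0 < \<nu>" and "\<nu> \<le> 1" and "0 < rate\<^sub>\<alpha>" and "0 < rate\<^sub>\<beta>"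
    and "prob_space.fractional_poisson_process M \<nu> rate\<^sub>\<beta> N"
    and "prob_space.poisson_process M rate\<^sub>\<alpha> N\<^sub>\<alpha>"
    and "prob_space.indep_processes M N\<^sub>\<alpha> N"
    and "1 \<le> k"
    and "prob_space.indep_vars M' (\<lambda>_. count_space UNIV) \<xi> {1..k}"
    and "\<And>j. j \<in> {1..k} \<Longrightarrow>
           prob_space.discrete_mittag_leffler M' \<nu> (rate\<^sub>\<alpha> powr \<nu> / rate\<^sub>\<beta>) (\<xi> j)"
  shows "distr M (count_space UNIV) (\<lambda>\<omega>. N\<^sub>\<alpha> (first_time N k \<omega>) \<omega>) =
         distr M' (count_space UNIV) (\<lambda>\<omega>. \<Sum>j=1..k. \<xi> j \<omega>)"
proof -
  interpret M: prob_space M by fact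
  interpret M': prob_space M' by fact
  obtain W where renewal: "M.renewal_counting_process W N"
    and surv: "\<And>i t. 0 \<le> t \<Longrightarrow>
      M.prob {\<omega> \<in> space M. t < W i \<omega>} = mittag_leffler \<nu> 1 (- rate\<^sub>\<beta> * t powr \<nu>)"
    using assms(7) unfolding M.fractional_poisson_process_def by blast
  let ?T = "arrival_time W k"
  have first: "first_time N k \<omega> = ?T \<omega>" if "\<omega> \<in> space M" for \<omega>
    using M.first_time_renewal[OF renewal that \<open>1 \<le> k\<close>] .
  have T0: "0 \<le> ?T \<omega>" if "\<omega> \<in> space M" for \<omega>
    using M.arrival_time_pos[OF renewal that \<open>1 \<le> k\<close>] by simp
  have W_meas: "W i \<in> borel_measurable M" for i
    using renewal unfolding M.renewal_counting_process_def M.indep_vars_def by blast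
  have T: "?T \<in> borel_measurable M"
    unfolding arrival_time_def[abs_def] using W_meas by (intro borel_measurable_sum)
  have X: "(\<lambda>\<omega>. N\<^sub>\<alpha> (?T \<omega>) \<omega>) \<in> measurable M (count_space UNIV)"
    by (rule M.measurable_poisson_process_random_time[OF assms(8) \<open>0 < rate\<^sub>\<alpha>\<close> T T0])
  have Y: "(\<lambda>\<omega>. \<Sum>j=1..k. \<xi> j \<omega>) \<in> measurable M' (count_space UNIV)"
    using assms(11) unfolding M'.indep_vars_def
    by (intro measurable_sum_nat) auto
  have "distr M (count_space UNIV) (\<lambda>\<omega>. N\<^sub>\<alpha> (?T \<omega>) \<omega>) =
      distr M' (count_space UNIV) (\<lambda>\<omega>. \<Sum>j=1..k. \<xi> j \<omega>)"
  proof (rule pgf_unique)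
    fix u :: real
    assume u: "0 \<le> u" "u < 1"
    define s where "s = rate\<^sub>\<alpha> * (1 - u)"
    have s: "0 < s" "s powr \<nu> = rate\<^sub>\<alpha> powr \<nu> * (1 - u) powr \<nu>"
      using u assms by (auto simp: s_def powr_mult)
    have "(\<integral>n. u ^ n \<partial>distr M (count_space UNIV) (\<lambda>\<omega>. N\<^sub>\<alpha> (?T \<omega>) \<omega>)) =
        M.expectation (\<lambda>\<omega>. u ^ N\<^sub>\<alpha> (?T \<omega>) \<omega>)"
      using X by (rule integral_distr) simp
    also have "\<dots> = M.expectation (\<lambda>\<omega>. exp (- s * ?T \<omega>))"
      unfolding s_def
      by (rule M.pgf_poisson_process_random_time[OF assms(8) \<open>0 < rate\<^sub>\<alpha>\<close> T T0
          M.expectation_pgf_times_arrival_indicator[OF renewal \<open>1 \<le> k\<close> assms(9) u] u])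
    also have "\<dots> = (rate\<^sub>\<beta> / (rate\<^sub>\<beta> + s powr \<nu>)) ^ k"
      using assms s by (intro M.laplace_arrival_time[OF renewal surv])
    also have "rate\<^sub>\<beta> / (rate\<^sub>\<beta> + s powr \<nu>) =
        1 / (1 + rate\<^sub>\<alpha> powr \<nu> / rate\<^sub>\<beta> * (1 - u) powr \<nu>)"
    proof -
      \<comment> \<open>Factoring out \<open>rate\<^sub>\<beta>\<close> is where the parameter
        \<open>rate\<^sub>\<alpha> powr \<nu> / rate\<^sub>\<beta>\<close> arises.\<close>
      have "rate\<^sub>\<beta> + s powr \<nu> = rate\<^sub>\<beta> * (1 + rate\<^sub>\<alpha> powr \<nu> / rate\<^sub>\<beta> * (1 - u) powr \<nu>)"
        using assms s by (simp add: distrib_left)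
      then show ?thesis
        using assms by simp
    qed
    also have "\<dots> ^ k = (\<Prod>j=1..k. M'.expectation (\<lambda>\<omega>. u ^ \<xi> j \<omega>))"
      using M'.pgf_discrete_mittag_leffler[OF assms(12) u] by simp
    also have "\<dots> = M'.expectation (\<lambda>\<omega>. u ^ (\<Sum>j=1..k. \<xi> j \<omega>))"
      by (rule M'.pgf_sum_indep[OF assms(11) _ u, symmetric]) simp
    also have "\<dots> = (\<integral>n. u ^ n \<partial>distr M' (count_space UNIV) (\<lambda>\<omega>. \<Sum>j=1..k. \<xi> j \<omega>))"
      using Y by (rule integral_distr[symmetric]) simp
    finally show "(\<integral>n. u ^ n \<partial>distr M (count_space UNIV) (\<lambda>\<omega>. N\<^sub>\<alpha> (?T \<omega>) \<omega>)) = \<dots>" .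
  qed (use X Y in \<open>auto intro: M.prob_space_distr M'.prob_space_distr\<close>)
  moreover have "distr M (count_space UNIV) (\<lambda>\<omega>. N\<^sub>\<alpha> (first_time N k \<omega>) \<omega>) =
      distr M (count_space UNIV) (\<lambda>\<omega>. N\<^sub>\<alpha> (?T \<omega>) \<omega>)"
    by (intro distr_cong refl) (simp add: first)
  ultimately show ?thesis
    by simp
qed

end
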